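(* Let $Z$ be a continuous stationary centered Gaussian process indexed by $\mathbb{R}$ with $\mathbb{E}[Z_0^2]=1$ such that $$\lim_{t\to0}\mathbb{E}[(Z_t-Z_0)^2]=0,\qquad\bigcap_{t\in\mathbb{R}}\overline{sp}\{Z_s:-\infty<s\le t\}=\{0\},$$ where $\overline{sp}$ denotes the $L^2$-closure of the linear span of a set of square-integrable random variables. Let $\theta>0$. Then, for every $p>0$, there is $T_0>0$ such that $$\sup_{T\ge T_0}\mathbb{E}\left[\left(\frac1T\int_0^TZ_t^2dt\right)^{-p}\right]<\infty\quad\text{and}\quad\sup_{T\ge T_0}\mathbb{E}\left[\left(\frac1T\int_0^T(Z_t-e^{\theta t}Z_0)^2dt\right)^{-p}\right]<\infty.$$ Moreover, for every $p>0$, there is $n_0\ge1$ such that $$\sup_{n\ge n_0}\mathbb{E}\left[\left(\frac1n\sum_{i=1}^nZ_{t_i}^2\right)^{-p}\right]<\infty\quad\text{and}\quad\sup_{n\ge n_0}\mathbb{E}\left[\left(\frac1n\sum_{i=1}^n(Z_{t_i}-e^{\theta t_i}Z_0)^2\right)^{-p}\right]<\infty,$$ where $t_i=i\Delta_n$ for $i=1,\dots,n$, with $\Delta_n>0$, $n\Delta_n\to\infty$ and $\Delta_n\to0$ as $n\to\infty$. *)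

theory Defs
  imports "HOL-Probability.Probability"
begin

text \<open>The normal law with mean \<open>\<mu>\<close> and standard deviation \<open>\<sigma> \<ge> 0\<close>; the degenerate
  case \<open>\<sigma> = 0\<close> is the point mass, which \<open>normal_density\<close> does not cover.\<close>

definition normal_law :: "real \<Rightarrow> real \<Rightarrow> real measure" where
  "normal_law \<mu> \<sigma> =
     (if \<sigma> = 0 then return borel \<mu> else density lborel (\<lambda>x. ennreal (normal_density \<mu> \<sigma> x)))"

definition gaussian_rv :: "'a measure \<Rightarrow> ('a \<Rightarrow> real) \<Rightarrow> bool" where
  "gaussian_rv M X \<longleftrightarrow>
     X \<in> borel_measurable M \<and> (\<exists>\<mu> \<sigma>. \<sigma> \<ge> 0 \<and> distr M borel X = normal_law \<mu> \<sigma>)"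

definition gaussian_process :: "'a measure \<Rightarrow> (real \<Rightarrow> 'a \<Rightarrow> real) \<Rightarrow> bool" where
  "gaussian_process M Z \<longleftrightarrow>
     (\<forall>J c. finite J \<longrightarrow> gaussian_rv M (\<lambda>\<omega>. \<Sum>t\<in>J. c t * Z t \<omega>))"

definition centered_process :: "'a measure \<Rightarrow> (real \<Rightarrow> 'a \<Rightarrow> real) \<Rightarrow> bool" where
  "centered_process M Z \<longleftrightarrow> (\<forall>t. integrable M (Z t) \<and> integral\<^sup>L M (Z t) = 0)"

text \<open>Strict stationarity: the finite-dimensional distributions are shift invariant.\<close>

definition stationary_process :: "'a measure \<Rightarrow> (real \<Rightarrow> 'a \<Rightarrow> real) \<Rightarrow> bool" where
  "stationary_process M Z \<longleftrightarrow>
     (\<forall>J h. finite J \<longrightarrow>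
        distr M (\<Pi>\<^sub>M t\<in>J. borel) (\<lambda>\<omega>. \<lambda>t\<in>J. Z (t + h) \<omega>) =
        distr M (\<Pi>\<^sub>M t\<in>J. borel) (\<lambda>\<omega>. \<lambda>t\<in>J. Z t \<omega>))"

definition continuous_process :: "'a measure \<Rightarrow> (real \<Rightarrow> 'a \<Rightarrow> real) \<Rightarrow> bool" where
  "continuous_process M Z \<longleftrightarrow> (AE \<omega> in M. continuous_on UNIV (\<lambda>t. Z t \<omega>))"

definition L2_rvs :: "'a measure \<Rightarrow> ('a \<Rightarrow> real) set" where
  "L2_rvs M = {X \<in> borel_measurable M. integrable M (\<lambda>\<omega>. (X \<omega>)\<^sup>2)}"

text \<open>Elements of \<open>L\<^sup>2\<close> are represented by functions, so its zero element becomes the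
  class of all random variables that vanish almost surely.\<close>

definition L2_zero :: "'a measure \<Rightarrow> ('a \<Rightarrow> real) set" where
  "L2_zero M = {X \<in> borel_measurable M. AE \<omega> in M. X \<omega> = 0}"

definition lin_span :: "('a \<Rightarrow> real) set \<Rightarrow> ('a \<Rightarrow> real) set" where
  "lin_span S = {(\<lambda>\<omega>. \<Sum>X\<in>F. c X * X \<omega>) | F c. finite F \<and> F \<subseteq> S}"

definition L2_closure :: "'a measure \<Rightarrow> ('a \<Rightarrow> real) set \<Rightarrow> ('a \<Rightarrow> real) set" where
  "L2_closure M S =
     {X \<in> L2_rvs M. \<forall>\<epsilon>>0. \<exists>Y \<in> S \<inter> L2_rvs M. integral\<^sup>L M (\<lambda>\<omega>. (X \<omega> - Y \<omega>)\<^sup>2) < \<epsilon>}"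

text \<open>The expectation of \<open>X\<^sup>-\<^sup>p\<close> for \<open>X \<ge> 0\<close> and \<open>p > 0\<close>, as an extended nonnegative
  number with \<open>0\<^sup>-\<^sup>p = \<infinity>\<close>. The inverse is taken in \<open>ennreal\<close> because
  \<open>0 powr (- p) = 0\<close> in the reals.\<close>

definition neg_moment :: "'a measure \<Rightarrow> real \<Rightarrow> ('a \<Rightarrow> real) \<Rightarrow> ennreal" where
  "neg_moment M p X = (\<integral>\<^sup>+\<omega>. inverse (ennreal (X \<omega> powr p)) \<partial>M)"

end

theory Submission
  imports Defs "HOL-Real_Asymp.Real_Asymp"
begin

text \<open>Fix a deterministic function \<open>a\<close> and put \<open>Y\<^sub>t = Z\<^sub>t - a(t) Z\<^sub>0\<close>; the two
  processes of the theorem are the cases \<open>a = 0\<close> and \<open>a(t) = e\<^sup>\<theta>\<^sup>t\<close>. All four bounds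
  follow from one bound for \<open>E[(1/n \<Sum> Y\<^bsub>id\<^esub>\<^sup>2)\<^sup>-\<^sup>p]\<close> that is uniform in \<open>a\<close>, in the mesh
  \<open>d \<le> 1\<close> and in all \<open>n\<close> with \<open>n d \<ge> T0\<close> (\<open>discrete_neg_moment_bound\<close>). For
  continuous \<open>a\<close>, the integrals are limits of such averages along continuous paths, and Fatou's
  lemma passes the bound to the limit.

  The remote past is trivial, so for some lag \<open>L\<close> the variable \<open>Z\<^sub>0\<close> is not in the closed span
  of the \<open>Z\<^sub>s\<close> with \<open>s \<le> -L\<close>: it has at least a distance \<open>\<surd>\<epsilon> > 0\<close> from it. By stationarity the same
  \<open>\<epsilon>\<close> serves at every time (\<open>innovation_lower_bound\<close>). Hence for times
  \<open>0 = \<tau> 0, \<tau> 1, ..., \<tau> N\<close> with gaps at least \<open>L\<close>, the variance of \<open>\<Sum> \<eta>\<^sub>l Z\<^bsub>\<tau> l\<^esub>\<close> is at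
  least \<open>K\<^sup>-\<^sup>1 \<Sum> \<eta>\<^sub>l\<^sup>2\<close>, the second sum being over \<open>l \<ge> 1\<close> only, with \<open>K\<close> depending on \<open>N\<close>
  and \<open>\<epsilon>\<close> alone (\<open>coercive_on_separated_times\<close>). The coefficient of \<open>Z\<^sub>0\<close> is free here, and
  this is what makes everything uniform in \<open>a\<close>.

  Coercivity is converted into a Laplace transform bound
  \<open>E exp(-s \<Sum> Y\<^bsub>\<tau> l\<^esub>\<^sup>2) \<le> (1 + 2s/K)\<^bsup>-N/2\<^esup>\<close> (\<open>laplace_gaussian_vector_le\<close>) by writing the
  Gaussian function of the vector as the average of \<open>cos(\<Sum> \<xi>\<^sub>l Y\<^bsub>\<tau> l\<^esub>)\<close> over an independent
  Gaussian vector \<open>\<xi>\<close>; only the laws of linear combinations enter, and these are what the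
  definition of a Gaussian process describes. Integrating the Laplace
  transform against \<open>s\<^sup>k ds\<close> bounds the negative moments (\<open>inverse_moment_le_of_laplace\<close>).

  Finally the index set \<open>1, ..., n\<close> is cut into \<open>N + 1\<close> blocks of length \<open>k\<close> and a remainder. The
  blocks after the first form \<open>k\<close> arithmetic progressions of \<open>N\<close> times with gaps \<open>k d \<ge> L\<close>. The
  average over all times dominates a multiple of the average over the progressions, and by
  convexity of \<open>exp\<close> the Laplace bound of one progression passes to that average.\<close>

section \<open>Laplace transforms of squared Gaussian vectors\<close>

lemma integral_cos_std_normal:
  "(LINT x|std_normal_distribution. cos (t * x)) = exp (- t\<^sup>2 / 2)"
proof -
  interpret real_distribution std_normal_distribution
    by (rule real_dist_normal_dist)
  have int: "integrable std_normal_distribution (\<lambda>x. iexp (t * x))"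
    by (rule integrable_iexp) auto
  have "Re (char std_normal_distribution t) = (LINT x|std_normal_distribution. Re (iexp (t * x)))"
    unfolding char_def using int by (rule integral_Re[symmetric])
  then show ?thesis
    by (simp add: char_std_normal_distribution Re_exp)
qed

lemma integral_cos_normal_density:
  assumes "\<sigma> > 0"
  shows "(LINT x|lborel. normal_density 0 \<sigma> x * cos x) = exp (- \<sigma>\<^sup>2 / 2)"
proof -
  have scale: "\<sigma> * normal_density 0 \<sigma> (\<sigma> * x) = std_normal_density x" for x
    using assms by (simp add: normal_density_def real_sqrt_mult power_mult_distrib)
  have "(LINT x|lborel. normal_density 0 \<sigma> x * cos x)
      = (LINT x|lborel. (\<sigma> * normal_density 0 \<sigma> (\<sigma> * x)) * cos (\<sigma> * x))"
    using assms lborel_integral_real_affine[of \<sigma> "\<lambda>x. normal_density 0 \<sigma> x * cos x" 0]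
    by (simp add: mult.assoc flip: integral_mult_right_zero)
  also have "\<dots> = (LINT x|std_normal_distribution. cos (\<sigma> * x))"
    unfolding scale by (subst integral_density) auto
  finally show ?thesis
    by (simp add: integral_cos_std_normal)
qed

text \<open>The existential parameters in \<open>gaussian_rv\<close> are eliminated: the mean is the given one, the
  variance is the second moment, and the characteristic function takes the same form for the
  degenerate law.\<close>

lemma centered_gaussian_rv:
  assumes "prob_space M" and W: "gaussian_rv M W" and mean: "integral\<^sup>L M W = 0"
  shows "integrable M (\<lambda>\<omega>. (W \<omega>)\<^sup>2)"
    and "(LINT \<omega>|M. cos (W \<omega>)) = exp (- (LINT \<omega>|M. (W \<omega>)\<^sup>2) / 2)"
proof -
  interpret prob_space M by fact
  obtain \<mu> \<sigma> where \<sigma>: "\<sigma> \<ge> 0" and D: "distr M borel W = normal_law \<mu> \<sigma>"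
    and [measurable]: "W \<in> borel_measurable M"
    using W unfolding gaussian_rv_def by auto
  have tr: "(LINT \<omega>|M. f (W \<omega>)) = integral\<^sup>L (normal_law \<mu> \<sigma>) f"
    if [measurable]: "f \<in> borel_measurable borel" for f :: "real \<Rightarrow> real"
    unfolding D[symmetric] by (subst integral_distr) auto
  have tri: "integrable M (\<lambda>\<omega>. (W \<omega>)\<^sup>2) \<longleftrightarrow> integrable (normal_law \<mu> \<sigma>) (\<lambda>x. x\<^sup>2)"
    unfolding D[symmetric] by (subst integrable_distr_eq) auto
  have "integrable M (\<lambda>\<omega>. (W \<omega>)\<^sup>2) \<and>
    (LINT \<omega>|M. cos (W \<omega>)) = exp (- (LINT \<omega>|M. (W \<omega>)\<^sup>2) / 2)"
  proof (cases "\<sigma> = 0")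
    case True
    then have L: "normal_law \<mu> \<sigma> = return borel \<mu>"
      by (simp add: normal_law_def)
    have "\<mu> = 0"
      using tr[of "\<lambda>x. x"] mean by (simp add: L integral_return)
    moreover have "integrable (return borel \<mu>) (\<lambda>x::real. x\<^sup>2)"
    proof -
      interpret R: prob_space "return borel \<mu>" by (rule prob_space_return) simp
      show ?thesis
        by (rule R.integrable_const_bound[where B="\<mu>\<^sup>2"]) (auto simp: AE_return)
    qed
    ultimately show ?thesis
      using tr[of "\<lambda>x. x\<^sup>2"] tr[of cos] tri unfolding L by (simp add: integral_return)
  next
    case False
    then have \<sigma>: "\<sigma> > 0" using \<sigma> by simp
    have L: "normal_law \<mu> \<sigma> = density lborel (\<lambda>x. ennreal (normal_density \<mu> \<sigma> x))"
      using False by (simp add: normal_law_def)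
    have "\<mu> = 0"
      using tr[of "\<lambda>x. x"] mean integral_normal_moment_nz_1[OF \<sigma>, of \<mu>]
      by (simp add: L integral_density)
    moreover have "integrable lborel (\<lambda>x. normal_density 0 \<sigma> x * x\<^sup>2)"
      using integrable_normal_moment[OF \<sigma>, of 0 2] by simp
    moreover have "(LINT x|lborel. normal_density 0 \<sigma> x * x\<^sup>2) = \<sigma>\<^sup>2"
      using integral_normal_moment_even[OF \<sigma>, of 0 1] \<sigma> by (simp add: eval_nat_numeral)
    ultimately show ?thesis
      using tr[of "\<lambda>x. x\<^sup>2"] tr[of cos] tri integral_cos_normal_density[OF \<sigma>]
      unfolding L by (simp add: integral_density integrable_density)
  qed
  then show "integrable M (\<lambda>\<omega>. (W \<omega>)\<^sup>2)"
    and "(LINT \<omega>|M. cos (W \<omega>)) = exp (- (LINT \<omega>|M. (W \<omega>)\<^sup>2) / 2)"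
    by auto
qed

lemma integral_exp_square_std_normal:
  assumes "s \<ge> 0"
  shows "integrable std_normal_distribution (\<lambda>x. exp (- s * x\<^sup>2))"
    and "(LINT x|std_normal_distribution. exp (- s * x\<^sup>2)) = 1 / sqrt (1 + 2 * s)"
proof -
  define r where "r = 1 / sqrt (1 + 2 * s)"
  have r: "r > 0" "r\<^sup>2 = 1 / (1 + 2 * s)"
    using assms by (auto simp: r_def power_divide)
  have eq: "std_normal_density x * exp (- s * x\<^sup>2) = r * normal_density 0 r x" for x
  proof -
    have "- x\<^sup>2 / 2 + - s * x\<^sup>2 = - x\<^sup>2 / (2 * r\<^sup>2)"
      using assms by (simp add: r field_simps)
    then have "exp (- x\<^sup>2 / 2) * exp (- s * x\<^sup>2) = exp (- x\<^sup>2 / (2 * r\<^sup>2))"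
      by (simp flip: exp_add)
    then show ?thesis
      using r(1) by (simp add: normal_density_def real_sqrt_mult)
  qed
  interpret real_distribution std_normal_distribution
    by (rule real_dist_normal_dist)
  show "integrable std_normal_distribution (\<lambda>x. exp (- s * x\<^sup>2))"
    using assms by (intro integrable_const_bound[where B=1]) auto
  show "(LINT x|std_normal_distribution. exp (- s * x\<^sup>2)) = 1 / sqrt (1 + 2 * s)"
  proof -
    have "(LINT x|std_normal_distribution. exp (- s * x\<^sup>2))
        = (LINT x|lborel. std_normal_density x * exp (- s * x\<^sup>2))"
      by (subst integral_density) auto
    then show ?thesis
      unfolding eq using r(1) by (simp add: r_def)
  qed
qed

abbreviation std_normal_vector :: "'i set \<Rightarrow> ('i \<Rightarrow> real) measure" where
  "std_normal_vector I \<equiv> \<Pi>\<^sub>M i\<in>I. std_normal_distribution"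

lemma prob_space_std_normal: "prob_space std_normal_distribution"
  using real_dist_normal_dist by (simp add: real_distribution_def)

lemma product_sigma_finite_std_normal: "product_sigma_finite (\<lambda>_. std_normal_distribution)"
  unfolding product_sigma_finite_def
  using prob_space_std_normal by (simp add: prob_space_imp_sigma_finite)

lemma integral_cos_std_normal_vector:
  assumes "finite I"
  shows "(LINT \<xi>|std_normal_vector I. cos (\<Sum>i\<in>I. y i * \<xi> i)) = exp (- (\<Sum>i\<in>I. (y i)\<^sup>2) / 2)"
proof -
  interpret product_sigma_finite "\<lambda>_. std_normal_distribution"
    by (rule product_sigma_finite_std_normal)
  interpret real_distribution std_normal_distribution
    by (rule real_dist_normal_dist)
  interpret P: prob_space "std_normal_vector I"
    by (rule prob_space_PiM) (rule prob_space_std_normal)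
  have int: "integrable std_normal_distribution (\<lambda>x. iexp (y i * x))" for i
    by (rule integrable_iexp) auto
  have prod: "(\<Prod>i\<in>I. iexp (y i * \<xi> i)) = iexp (\<Sum>i\<in>I. y i * \<xi> i)" for \<xi>
    using assms by (simp add: sum_distrib_left flip: exp_sum)
  have int_prod: "integrable (std_normal_vector I) (\<lambda>\<xi>. iexp (\<Sum>i\<in>I. y i * \<xi> i))"
    by (rule P.integrable_iexp) auto
  have "(LINT \<xi>|std_normal_vector I. iexp (\<Sum>i\<in>I. y i * \<xi> i))
      = (\<Prod>i\<in>I. char std_normal_distribution (y i))"
    using product_integral_prod[OF assms, where f="\<lambda>i x. iexp (y i * x)"] int
    by (simp only: prod char_def)
  also have "\<dots> = complex_of_real (exp (- (\<Sum>i\<in>I. (y i)\<^sup>2) / 2))"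
    using assms by (simp add: char_std_normal_distribution sum_divide_distrib
        flip: of_real_prod exp_sum sum_negf)
  finally have *: "Re (LINT \<xi>|std_normal_vector I. iexp (\<Sum>i\<in>I. y i * \<xi> i))
      = exp (- (\<Sum>i\<in>I. (y i)\<^sup>2) / 2)"
    by simp
  have "(LINT \<xi>|std_normal_vector I. cos (\<Sum>i\<in>I. y i * \<xi> i))
     = (LINT \<xi>|std_normal_vector I. Re (iexp (\<Sum>i\<in>I. y i * \<xi> i)))"
    by (simp add: Re_exp)
  also have "\<dots> = exp (- (\<Sum>i\<in>I. (y i)\<^sup>2) / 2)"
    using int_prod * by (subst integral_Re) auto
  finally show ?thesis .
qed

text \<open>With \<open>\<xi>\<close> standard normal in \<open>\<real>\<^sup>I\<close> and independent of \<open>Y\<close>,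
  \<open>exp (- s |Y|\<^sup>2) = E\<^sub>\<xi> cos (\<surd>(2s) \<Sum> \<xi>\<^sub>i Y\<^sub>i)\<close>. Exchanging the two expectations leaves, for each
  \<open>\<xi>\<close>, the characteristic function of one Gaussian combination, which the coercivity of the
  covariance bounds by a product of one-dimensional Gaussian functions of the \<open>\<xi>\<^sub>i\<close>.\<close>

lemma laplace_gaussian_vector_le:
  fixes Y :: "'i \<Rightarrow> 'a \<Rightarrow> real"
  assumes M: "prob_space M" and I: "finite I" and Ym [measurable]: "\<And>i. Y i \<in> borel_measurable M"
    and gauss: "\<And>\<eta>. gaussian_rv M (\<lambda>\<omega>. \<Sum>i\<in>I. \<eta> i * Y i \<omega>)"
    and mean: "\<And>\<eta>. (LINT \<omega>|M. (\<Sum>i\<in>I. \<eta> i * Y i \<omega>)) = 0"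
    and coercive: "\<And>\<eta>. (\<Sum>i\<in>I. (\<eta> i)\<^sup>2) \<le> K * (LINT \<omega>|M. (\<Sum>i\<in>I. \<eta> i * Y i \<omega>)\<^sup>2)"
    and K: "K > 0" and s: "s \<ge> 0"
  shows "(LINT \<omega>|M. exp (- s * (\<Sum>i\<in>I. (Y i \<omega>)\<^sup>2))) \<le> (1 / sqrt (1 + 2 * s / K)) ^ card I"
proof -
  interpret M: prob_space M by fact
  interpret product_sigma_finite "\<lambda>_. std_normal_distribution"
    by (rule product_sigma_finite_std_normal)
  interpret P: prob_space "std_normal_vector I"
    by (rule prob_space_PiM) (rule prob_space_std_normal)
  interpret MP: pair_prob_space M "std_normal_vector I" ..
  define f where "f \<omega> \<xi> = cos (\<Sum>i\<in>I. (sqrt (2 * s) * Y i \<omega>) * \<xi> i)" for \<omega> \<xi>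
  have f_int: "integrable (M \<Otimes>\<^sub>M std_normal_vector I) (case_prod f)"
    unfolding f_def by (intro MP.integrable_const_bound[where B=1]) auto
  have inner1: "(LINT \<xi>|std_normal_vector I. f \<omega> \<xi>) = exp (- s * (\<Sum>i\<in>I. (Y i \<omega>)\<^sup>2))" for \<omega>
    unfolding f_def integral_cos_std_normal_vector[OF I] using s
    by (simp add: power_mult_distrib flip: sum_distrib_left)
  have inner2: "(LINT \<omega>|M. f \<omega> \<xi>) \<le> (\<Prod>i\<in>I. exp (- (s / K) * (\<xi> i)\<^sup>2))" for \<xi>
  proof -
    define W where "W \<omega> = (\<Sum>i\<in>I. (sqrt (2 * s) * \<xi> i) * Y i \<omega>)" for \<omega>
    have "(LINT \<omega>|M. f \<omega> \<xi>) = (LINT \<omega>|M. cos (W \<omega>))"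
      by (simp add: f_def W_def mult_ac)
    also have "\<dots> = exp (- (LINT \<omega>|M. (W \<omega>)\<^sup>2) / 2)"
      unfolding W_def by (intro centered_gaussian_rv(2) M gauss mean)
    also have "\<dots> \<le> exp (- (s / K) * (\<Sum>i\<in>I. (\<xi> i)\<^sup>2))"
    proof -
      have "2 * s * (\<Sum>i\<in>I. (\<xi> i)\<^sup>2) \<le> K * (LINT \<omega>|M. (W \<omega>)\<^sup>2)"
        using coercive[of "\<lambda>i. sqrt (2 * s) * \<xi> i"] s
        by (simp add: W_def power_mult_distrib sum_distrib_left)
      then show ?thesis
        using K by (simp add: field_simps)
    qed
    also have "\<dots> = (\<Prod>i\<in>I. exp (- (s / K) * (\<xi> i)\<^sup>2))"
      using I by (simp add: sum_distrib_left flip: exp_sum)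
    finally show ?thesis .
  qed
  have "(LINT \<omega>|M. exp (- s * (\<Sum>i\<in>I. (Y i \<omega>)\<^sup>2))) = (LINT \<xi>|std_normal_vector I. (LINT \<omega>|M. f \<omega> \<xi>))"
    unfolding inner1[symmetric] by (rule MP.Fubini_integral[OF f_int, symmetric])
  also have "\<dots> \<le> (LINT \<xi>|std_normal_vector I. (\<Prod>i\<in>I. exp (- (s / K) * (\<xi> i)\<^sup>2)))"
  proof (rule integral_mono)
    show "integrable (std_normal_vector I) (\<lambda>\<xi>. LINT \<omega>|M. f \<omega> \<xi>)"
      using MP.integrable_snd[OF f_int] .
    show "integrable (std_normal_vector I) (\<lambda>\<xi>. \<Prod>i\<in>I. exp (- (s / K) * (\<xi> i)\<^sup>2))"
      using s K by (intro product_integrable_prod I integral_exp_square_std_normal(1)) auto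
  qed (rule inner2)
  also have "\<dots> = (\<Prod>i\<in>I. LINT x|std_normal_distribution. exp (- (s / K) * x\<^sup>2))"
    using s K by (intro product_integral_prod I integral_exp_square_std_normal(1)) auto
  also have "\<dots> = (1 / sqrt (1 + 2 * s / K)) ^ card I"
    using s K by (subst integral_exp_square_std_normal(2)) auto
  finally show ?thesis .
qed

section \<open>From Laplace transforms to negative moments\<close>

text \<open>The Gamma integral. For \<open>x = 0\<close> both sides are infinite, so the identity also covers random
  variables with an atom at zero.\<close>

lemma nn_integral_power_exp:
  assumes "x \<ge> 0"
  shows "inverse (ennreal (x ^ Suc k)) * fact k =
    (\<integral>\<^sup>+s. ennreal (s ^ k * exp (- s * x)) * indicator {0..} s \<partial>lborel)"
proof (cases "x = 0")
  case True
  have "of_nat n \<le> (\<integral>\<^sup>+s. ennreal (s ^ k * exp (- s * x)) * indicator {0..} s \<partial>lborel)" for n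
  proof -
    have "of_nat n = emeasure lborel {1::real..1 + real n}"
      by (simp add: ennreal_of_nat_eq_real_of_nat)
    also have "\<dots> = (\<integral>\<^sup>+s. indicator {1::real..1 + real n} s \<partial>lborel)"
      by simp
    also have "\<dots> \<le> (\<integral>\<^sup>+s. ennreal (s ^ k * exp (- s * x)) * indicator {0..} s \<partial>lborel)"
      using True by (intro nn_integral_mono) (auto simp: indicator_def)
    finally show ?thesis .
  qed
  then have "(\<integral>\<^sup>+s. ennreal (s ^ k * exp (- s * x)) * indicator {0..} s \<partial>lborel) = \<top>"
    by (metis ennreal_Ex_less_of_nat less_top leD)
  then show ?thesis
    using True by (simp add: ennreal_top_mult)
next
  case False
  then have x: "x > 0" using assms by simp
  let ?I = "\<integral>\<^sup>+s. ennreal (s ^ k * exp (- s * x)) * indicator {0..} s \<partial>lborel"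
  have "1 = (\<integral>\<^sup>+s. ennreal (erlang_density k x s) \<partial>lborel)"
    using prob_space.emeasure_space_1[OF prob_space_erlang_density[OF x, of k]]
    by (simp add: emeasure_density)
  also have "\<dots> = (\<integral>\<^sup>+s. ennreal (x ^ Suc k / fact k) * (ennreal (s ^ k * exp (- s * x)) * indicator {0..} s) \<partial>lborel)"
    using x by (intro nn_integral_cong)
      (auto simp: erlang_density_def ennreal_mult[symmetric] indicator_def mult_ac)
  also have "\<dots> = ennreal (x ^ Suc k / fact k) * ?I"
    by (rule nn_integral_cmult) auto
  finally have 1: "ennreal (x ^ Suc k / fact k) * ?I = 1" ..
  have fact: "(fact k :: ennreal) = ennreal (fact k)"
    by (metis ennreal_of_nat_eq_real_of_nat of_nat_fact)
  have "inverse (ennreal (x ^ Suc k)) * fact k = ennreal (fact k / x ^ Suc k)"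
    using x unfolding fact
    by (subst inverse_ennreal) (auto simp: ennreal_mult[symmetric] divide_inverse mult_ac)
  also have "\<dots> = ennreal (fact k / x ^ Suc k) * (ennreal (x ^ Suc k / fact k) * ?I)"
    by (simp only: 1 mult_1_right)
  also have "\<dots> = (ennreal (fact k / x ^ Suc k) * ennreal (x ^ Suc k / fact k)) * ?I"
    by (rule mult.assoc[symmetric])
  also have "ennreal (fact k / x ^ Suc k) * ennreal (x ^ Suc k / fact k) = 1"
    using x by (subst ennreal_mult[symmetric]) auto
  also have "1 * ?I = ?I"
    by (rule mult_1)
  finally show ?thesis .
qed

lemma nn_integral_inverse_square: "(\<integral>\<^sup>+s. ennreal (1 / (1 + s)\<^sup>2) * indicator {0..} s \<partial>lborel) = 1"
proof -
  have "(\<integral>\<^sup>+s. ennreal (1 / (1 + s)\<^sup>2) * indicator {0..} s \<partial>lborel) = ennreal (0 - (- (1 / (1 + 0))))"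
  proof (rule nn_integral_FTC_atLeast)
    show "((\<lambda>s::real. - (1 / (1 + s))) \<longlongrightarrow> 0) at_top"
      by real_asymp
  qed (auto intro!: derivative_eq_intros simp: field_simps power2_eq_square)
  then show ?thesis by simp
qed

text \<open>Tonelli turns the moment into \<open>\<integral> s\<^sup>k E e\<^bsup>-sX\<^esup> ds / k!\<close>, and a decay of order \<open>k + 2\<close> leaves the
  integrable function \<open>(1 + s)\<^sup>-\<^sup>2\<close>.\<close>

lemma inverse_moment_le_of_laplace:
  fixes X :: "'a \<Rightarrow> real"
  assumes M: "prob_space M" and X [measurable]: "X \<in> borel_measurable M"
    and nonneg: "\<And>\<omega>. X \<omega> \<ge> 0" and c: "0 < c" "c \<le> 1"
    and laplace: "\<And>s. s \<ge> 0 \<Longrightarrow> (LINT \<omega>|M. exp (- s * X \<omega>)) \<le> 1 / (1 + c * s) ^ (k + 2)"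
  shows "(\<integral>\<^sup>+\<omega>. inverse (ennreal (X \<omega> ^ Suc k)) \<partial>M) \<le> ennreal (1 / c ^ (k + 2))"
proof -
  interpret prob_space M by fact
  interpret P: pair_sigma_finite M lborel ..
  have int: "integrable M (\<lambda>\<omega>. exp (- s * X \<omega>))" if "s \<ge> 0" for s
    using that nonneg by (intro integrable_const_bound[where B=1]) auto
  have "(\<integral>\<^sup>+\<omega>. inverse (ennreal (X \<omega> ^ Suc k)) \<partial>M) \<le> (\<integral>\<^sup>+\<omega>. inverse (ennreal (X \<omega> ^ Suc k)) * fact k \<partial>M)"
    using mult_left_mono[of 1 "fact k :: ennreal"] fact_ge_1[of k, where 'a=real]
    by (intro nn_integral_mono) (metis ennreal_1 ennreal_fact ennreal_leI mult.right_neutral zero_le)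
  also have "\<dots> = (\<integral>\<^sup>+\<omega>. (\<integral>\<^sup>+s. ennreal (s ^ k * exp (- s * X \<omega>)) * indicator {0..} s \<partial>lborel) \<partial>M)"
    by (simp only: nn_integral_power_exp nonneg)
  also have "\<dots> = (\<integral>\<^sup>+s. (\<integral>\<^sup>+\<omega>. ennreal (s ^ k * exp (- s * X \<omega>)) * indicator {0..} s \<partial>M) \<partial>lborel)"
    by (rule P.Fubini'[symmetric]) auto
  also have "\<dots> \<le> (\<integral>\<^sup>+s. ennreal (1 / c ^ (k + 2)) * (ennreal (1 / (1 + s)\<^sup>2) * indicator {0..} s) \<partial>lborel)"
  proof (rule nn_integral_mono)
    fix s :: real
    show "(\<integral>\<^sup>+\<omega>. ennreal (s ^ k * exp (- s * X \<omega>)) * indicator {0..} s \<partial>M)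
      \<le> ennreal (1 / c ^ (k + 2)) * (ennreal (1 / (1 + s)\<^sup>2) * indicator {0..} s)"
    proof (cases "s \<ge> 0")
      case True
      have "(\<integral>\<^sup>+\<omega>. ennreal (s ^ k * exp (- s * X \<omega>)) \<partial>M) = ennreal (s ^ k * (LINT \<omega>|M. exp (- s * X \<omega>)))"
        using True int[OF True] by (subst nn_integral_eq_integral) auto
      also have "s ^ k * (LINT \<omega>|M. exp (- s * X \<omega>)) \<le> s ^ k * (1 / (1 + c * s) ^ (k + 2))"
        using laplace[OF True] True by (intro mult_left_mono) auto
      \<comment> \<open>Since \<open>c \<le> 1\<close>, the base \<open>1 + c s\<close> is at least \<open>c (1 + s)\<close>.\<close>
      also have "\<dots> \<le> (1 + s) ^ k * (1 / (c * (1 + s)) ^ (k + 2))"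
      proof -
        have "(c * (1 + s)) ^ (k + 2) \<le> (1 + c * s) ^ (k + 2)"
          using True c by (intro power_mono) (simp_all add: algebra_simps)
        moreover have "0 < (c * (1 + s)) ^ (k + 2)"
          using True c by (intro zero_less_power mult_pos_pos) auto
        ultimately have "1 / (1 + c * s) ^ (k + 2) \<le> 1 / (c * (1 + s)) ^ (k + 2)"
          by (intro frac_le) auto
        then show ?thesis
          using True c by (intro mult_mono power_mono) (auto intro!: divide_nonneg_nonneg)
      qed
      also have "\<dots> = 1 / c ^ (k + 2) * (1 / (1 + s)\<^sup>2)"
        using True c by (simp only: power_mult_distrib power_add[of _ k 2]) simp
      finally show ?thesis
        using True c by (simp add: ennreal_leI ennreal_mult[symmetric])
    qed simp
  qed
  also have "\<dots> = ennreal (1 / c ^ (k + 2)) * 1"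
    by (subst nn_integral_cmult) (auto simp: nn_integral_inverse_square)
  finally show ?thesis by simp
qed

lemma inverse_powr_le_one_plus:
  assumes "x \<ge> 0" "p > 0" "p \<le> real q"
  shows "inverse (ennreal (x powr p)) \<le> 1 + inverse (ennreal (x ^ q))"
proof -
  consider "x = 0" | "0 < x" "x < 1" | "x \<ge> 1"
    using assms by linarith
  then show ?thesis
  proof cases
    case 1
    then have "x ^ q = 0"
      using assms by simp
    then show ?thesis
      unfolding \<open>x ^ q = 0\<close> by simp
  next
    case 2
    then have "x powr real q \<le> x powr p"
      using assms by (intro powr_mono') auto
    then have "x ^ q \<le> x powr p"
      using 2 by (simp add: powr_realpow)
    then have "inverse (ennreal (x powr p)) \<le> inverse (ennreal (x ^ q))"
      using 2 by (simp add: inverse_ennreal le_imp_inverse_le ennreal_leI)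
    then show ?thesis
      by (simp add: add_increasing)
  next
    case 3
    then have "1 \<le> x powr p"
      using assms by (simp add: ge_one_powr_ge_zero)
    then have "inverse (ennreal (x powr p)) \<le> 1"
      by (subst inverse_ennreal) (auto intro!: inverse_le_1_iff[THEN iffD2])
    then show ?thesis
      by (simp add: add_increasing2)
  qed
qed

section \<open>Linear combinations of a stationary Gaussian process\<close>

locale stationary_gaussian = prob_space M for M :: "'a measure" +
  fixes Z :: "real \<Rightarrow> 'a \<Rightarrow> real"
  assumes gaussian: "gaussian_process M Z"
    and stationary: "stationary_process M Z"
    and centered: "centered_process M Z"
    and unit_variance: "(LINT \<omega>|M. (Z 0 \<omega>)\<^sup>2) = 1"
begin

lemma Z_measurable [measurable]: "Z t \<in> borel_measurable M"
  using gaussian[unfolded gaussian_process_def, rule_format, of "{t}" "\<lambda>_. 1"]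
  by (simp add: gaussian_rv_def)

text \<open>The definition of a Gaussian process speaks of sums over sets of times, whereas the sums below
  run over indices; times that occur more than once have their coefficients added.\<close>

lemma combination_as_set_sum:
  assumes "finite I"
  obtains c' where "\<And>\<omega>. (\<Sum>i\<in>I. c i * Z (\<tau> i) \<omega>) = (\<Sum>t\<in>\<tau> ` I. c' t * Z t \<omega>)"
proof
  fix \<omega>
  have "(\<Sum>i\<in>I. c i * Z (\<tau> i) \<omega>) = (\<Sum>t\<in>\<tau> ` I. \<Sum>i\<in>{i\<in>I. \<tau> i = t}. c i * Z (\<tau> i) \<omega>)"
    using assms by (rule sum.image_gen)
  also have "\<dots> = (\<Sum>t\<in>\<tau> ` I. (\<Sum>i\<in>{i\<in>I. \<tau> i = t}. c i) * Z t \<omega>)"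
    by (simp add: sum_distrib_right)
  finally show "(\<Sum>i\<in>I. c i * Z (\<tau> i) \<omega>) = (\<Sum>t\<in>\<tau> ` I. (\<Sum>i\<in>{i\<in>I. \<tau> i = t}. c i) * Z t \<omega>)" .
qed

lemma combination:
  assumes "finite I"
  shows gaussian_rv_combination: "gaussian_rv M (\<lambda>\<omega>. \<Sum>i\<in>I. c i * Z (\<tau> i) \<omega>)"
    and mean_combination: "(LINT \<omega>|M. (\<Sum>i\<in>I. c i * Z (\<tau> i) \<omega>)) = 0"
    and integrable_combination_square: "integrable M (\<lambda>\<omega>. (\<Sum>i\<in>I. c i * Z (\<tau> i) \<omega>)\<^sup>2)"
proof -
  obtain c' where c': "\<And>\<omega>. (\<Sum>i\<in>I. c i * Z (\<tau> i) \<omega>) = (\<Sum>t\<in>\<tau> ` I. c' t * Z t \<omega>)"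
    using combination_as_set_sum[OF assms] by blast
  show 1: "gaussian_rv M (\<lambda>\<omega>. \<Sum>i\<in>I. c i * Z (\<tau> i) \<omega>)"
    using gaussian[unfolded gaussian_process_def, rule_format, of "\<tau> ` I" c'] assms
    unfolding c' by simp
  show 2: "(LINT \<omega>|M. (\<Sum>i\<in>I. c i * Z (\<tau> i) \<omega>)) = 0"
    using centered unfolding centered_process_def
    by (subst Bochner_Integration.integral_sum) auto
  show "integrable M (\<lambda>\<omega>. (\<Sum>i\<in>I. c i * Z (\<tau> i) \<omega>)\<^sup>2)"
    by (rule centered_gaussian_rv(1)[OF prob_space_axioms 1 2])
qed

lemma second_moment_shift:
  assumes J: "finite J"
  shows "(LINT \<omega>|M. (\<Sum>t\<in>J. c t * Z (t + h) \<omega>)\<^sup>2) = (LINT \<omega>|M. (\<Sum>t\<in>J. c t * Z t \<omega>)\<^sup>2)"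
proof -
  define P where "P = (\<Pi>\<^sub>M t\<in>J. (borel :: real measure))"
  define f where "f x = (\<Sum>t\<in>J. c t * x t)\<^sup>2" for x :: "real \<Rightarrow> real"
  have [measurable]: "f \<in> borel_measurable P"
    unfolding f_def P_def by measurable
  have [measurable]: "(\<lambda>\<omega>. \<lambda>t\<in>J. Z (t + h) \<omega>) \<in> measurable M P" for h
    unfolding P_def by measurable
  have [measurable]: "(\<lambda>\<omega>. \<lambda>t\<in>J. Z t \<omega>) \<in> measurable M P"
    unfolding P_def by measurable
  have "(LINT \<omega>|M. f (\<lambda>t\<in>J. Z (t + h) \<omega>)) = integral\<^sup>L (distr M P (\<lambda>\<omega>. \<lambda>t\<in>J. Z (t + h) \<omega>)) f"
    by (subst integral_distr) auto
  also have "\<dots> = integral\<^sup>L (distr M P (\<lambda>\<omega>. \<lambda>t\<in>J. Z t \<omega>)) f"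
    using stationary J by (simp add: stationary_process_def P_def)
  also have "\<dots> = (LINT \<omega>|M. f (\<lambda>t\<in>J. Z t \<omega>))"
    by (subst integral_distr) auto
  finally show ?thesis
    by (simp add: f_def)
qed

lemma variance_one: "(LINT \<omega>|M. (Z t \<omega>)\<^sup>2) = 1"
  using second_moment_shift[of "{0}" "\<lambda>_. 1" t] unit_variance by simp

text \<open>If \<open>Z\<^sub>0\<close> were in every remote past, it would vanish almost surely, against \<open>E Z\<^sub>0\<^sup>2 = 1\<close>. So it
  keeps a positive distance from the past before some time; stationarity moves this statement
  from time \<open>0\<close> to time \<open>s\<close>.\<close>

lemma innovation_lower_bound:
  assumes tail: "(\<Inter>t::real. L2_closure M (lin_span {Z s | s. s \<le> t})) = L2_zero M"
  obtains L \<epsilon> where "L > 0" "\<epsilon> > 0"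
    "\<And>s J c. finite J \<Longrightarrow> (\<And>t. t \<in> J \<Longrightarrow> t \<le> s - L) \<Longrightarrow>
      \<epsilon> \<le> (LINT \<omega>|M. (Z s \<omega> + (\<Sum>t\<in>J. c t * Z t \<omega>))\<^sup>2)"
proof -
  have Z0: "Z 0 \<in> L2_rvs M"
    using integrable_combination_square[of "{0}" "\<lambda>_. 1" "\<lambda>t. t"] unfolding L2_rvs_def by simp
  have "Z 0 \<notin> L2_zero M"
  proof
    assume "Z 0 \<in> L2_zero M"
    then have "AE \<omega> in M. (Z 0 \<omega>)\<^sup>2 = 0"
      by (auto simp: L2_zero_def)
    then have "(LINT \<omega>|M. (Z 0 \<omega>)\<^sup>2) = 0"
      by (intro integral_eq_zero_AE) simp
    with unit_variance show False by simp
  qed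
  then obtain u where "Z 0 \<notin> L2_closure M (lin_span {Z s | s. s \<le> u})"
    unfolding tail[symmetric] by auto
  then obtain \<epsilon> where \<epsilon>: "\<epsilon> > 0"
    and far: "\<And>Y. Y \<in> lin_span {Z s | s. s \<le> u} \<inter> L2_rvs M \<Longrightarrow> \<epsilon> \<le> (LINT \<omega>|M. (Z 0 \<omega> - Y \<omega>)\<^sup>2)"
    using Z0 by (auto simp: L2_closure_def not_less)
  \<comment> \<open>A past further back spans less, so the lag may be increased to be positive.\<close>
  define L where "L = max 1 (- u)"
  have at_0: "\<epsilon> \<le> (LINT \<omega>|M. (Z 0 \<omega> + (\<Sum>t\<in>J. c t * Z t \<omega>))\<^sup>2)"
    if J: "finite J" "\<And>t. t \<in> J \<Longrightarrow> t \<le> - L" for J c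
  proof -
    define Y where "Y \<omega> = (\<Sum>t\<in>J. - c t * Z t \<omega>)" for \<omega>
    have "Y \<omega> = (\<Sum>X\<in>Z ` J. (\<Sum>t\<in>{t\<in>J. Z t = X}. - c t) * X \<omega>)" for \<omega>
    proof -
      have "Y \<omega> = (\<Sum>X\<in>Z ` J. \<Sum>t\<in>{t\<in>J. Z t = X}. - c t * Z t \<omega>)"
        unfolding Y_def using J(1) by (rule sum.image_gen)
      also have "\<dots> = (\<Sum>X\<in>Z ` J. (\<Sum>t\<in>{t\<in>J. Z t = X}. - c t) * X \<omega>)"
        unfolding sum_distrib_right by (intro sum.cong) auto
      finally show ?thesis .
    qed
    moreover have "Z ` J \<subseteq> {Z s | s. s \<le> u}"
      using J(2) by (force simp: L_def)
    ultimately have "Y \<in> lin_span {Z s | s. s \<le> u}"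
      using J(1) unfolding lin_span_def mem_Collect_eq
      by (intro exI[of _ "Z ` J"] exI[of _ "\<lambda>X. \<Sum>t\<in>{t\<in>J. Z t = X}. - c t"] conjI ext) simp_all
    moreover have "Y \<in> L2_rvs M"
      unfolding Y_def L2_rvs_def using integrable_combination_square[OF J(1), of "\<lambda>t. - c t" "\<lambda>t. t"]
      by simp
    ultimately have "\<epsilon> \<le> (LINT \<omega>|M. (Z 0 \<omega> - Y \<omega>)\<^sup>2)"
      by (intro far) auto
    then show ?thesis
      by (simp add: Y_def sum_negf)
  qed
  show thesis
  proof (rule that[of L \<epsilon>])
    show "L > 0" by (simp add: L_def)
    show "\<epsilon> > 0" by fact
    fix s :: real and J and c :: "real \<Rightarrow> real"
    assume J: "finite J" "\<And>t. t \<in> J \<Longrightarrow> t \<le> s - L"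
    define J' where "J' = (\<lambda>t. t - s) ` J"
    have J': "finite J'" "\<And>t. t \<in> J' \<Longrightarrow> t \<le> - L"
      using J by (force simp: J'_def)+
    define c' where "c' = (\<lambda>t. c (t + s))(0 := 1)"
    have "0 \<notin> J'"
      using J'(2)[of 0] by (auto simp: L_def)
    have c'_eq: "(\<Sum>t\<in>insert 0 J'. c' t * V t) = V 0 + (\<Sum>t\<in>J'. c (t + s) * V t)" for V :: "real \<Rightarrow> real"
      using J'(1) \<open>0 \<notin> J'\<close> by (auto simp: c'_def intro!: sum.cong)
    have inj: "inj_on (\<lambda>t. t - s) J"
      by (auto simp: inj_on_def)
    have "\<epsilon> \<le> (LINT \<omega>|M. (Z 0 \<omega> + (\<Sum>t\<in>J'. c (t + s) * Z t \<omega>))\<^sup>2)"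
      using J' by (rule at_0)
    also have "\<dots> = (LINT \<omega>|M. (\<Sum>t\<in>insert 0 J'. c' t * Z t \<omega>)\<^sup>2)"
      by (simp only: c'_eq)
    also have "\<dots> = (LINT \<omega>|M. (\<Sum>t\<in>insert 0 J'. c' t * Z (t + s) \<omega>)\<^sup>2)"
      using J'(1) by (intro second_moment_shift[symmetric]) simp
    also have "\<dots> = (LINT \<omega>|M. (Z s \<omega> + (\<Sum>t\<in>J'. c (t + s) * Z (t + s) \<omega>))\<^sup>2)"
      by (simp add: c'_eq)
    also have "\<dots> = (LINT \<omega>|M. (Z s \<omega> + (\<Sum>t\<in>J. c t * Z t \<omega>))\<^sup>2)"
      unfolding J'_def by (simp add: sum.reindex[OF inj])
    finally show "\<epsilon> \<le> (LINT \<omega>|M. (Z s \<omega> + (\<Sum>t\<in>J. c t * Z t \<omega>))\<^sup>2)" .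
  qed
qed

text \<open>Induction on the number of times. The newest coefficient is controlled by the innovation bound;
  once it is known, removing its term changes the variance by a controlled amount, and the
  induction hypothesis controls the others. The coefficient \<open>\<eta> 0\<close> does not enter the left-hand
  side: no bound on it is available in the intended application, where it is a combination of
  the arbitrary values \<open>a(t)\<close>.\<close>

lemma coercive_on_separated_times:
  assumes L: "L > 0" and \<epsilon>: "\<epsilon> > 0"
    and innovation: "\<And>s J c. finite J \<Longrightarrow> (\<And>t. t \<in> J \<Longrightarrow> t \<le> s - L) \<Longrightarrow>
      \<epsilon> \<le> (LINT \<omega>|M. (Z s \<omega> + (\<Sum>t\<in>J. c t * Z t \<omega>))\<^sup>2)"
  shows "\<exists>K\<ge>0. \<forall>\<tau> \<eta>. (\<forall>l. \<tau> l + L \<le> \<tau> (Suc l)) \<longrightarrow>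
    (\<Sum>l=1..m. (\<eta> l)\<^sup>2) \<le> K * (LINT \<omega>|M. (\<Sum>l\<le>m. \<eta> l * Z (\<tau> l) \<omega>)\<^sup>2)"
proof (induction m)
  case 0
  then show ?case by auto
next
  case (Suc m)
  then obtain K where K: "K \<ge> 0" and IH: "\<And>\<tau> \<eta>. (\<forall>l. \<tau> l + L \<le> \<tau> (Suc l)) \<Longrightarrow>
    (\<Sum>l=1..m. (\<eta> l)\<^sup>2) \<le> K * (LINT \<omega>|M. (\<Sum>l\<le>m. \<eta> l * Z (\<tau> l) \<omega>)\<^sup>2)"
    by blast
  show ?case
  proof (intro exI[of _ "1 / \<epsilon> + (2 + 2 / \<epsilon>) * K"] conjI allI impI)
    show "1 / \<epsilon> + (2 + 2 / \<epsilon>) * K \<ge> 0"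
      using \<epsilon> K by simp
    fix \<tau> :: "nat \<Rightarrow> real" and \<eta> :: "nat \<Rightarrow> real"
    assume gap: "\<forall>l. \<tau> l + L \<le> \<tau> (Suc l)"
    define W where "W n \<omega> = (\<Sum>l\<le>n. \<eta> l * Z (\<tau> l) \<omega>)" for n \<omega>
    define Q where "Q n = (LINT \<omega>|M. (W n \<omega>)\<^sup>2)" for n
    have W_int: "integrable M (\<lambda>\<omega>. (W n \<omega>)\<^sup>2)" for n
      unfolding W_def by (rule integrable_combination_square) simp
    have W_Suc: "W (Suc m) \<omega> = W m \<omega> + \<eta> (Suc m) * Z (\<tau> (Suc m)) \<omega>" for \<omega>
      by (simp add: W_def)
    have Q_nonneg: "Q n \<ge> 0" for n
      by (simp add: Q_def)
    have last: "(\<eta> (Suc m))\<^sup>2 \<le> 1 / \<epsilon> * Q (Suc m)"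
    proof (cases "\<eta> (Suc m) = 0")
      case True
      then show ?thesis using Q_nonneg \<epsilon> by simp
    next
      case False
      obtain c where c: "\<And>\<omega>. (\<Sum>l\<le>m. (\<eta> l / \<eta> (Suc m)) * Z (\<tau> l) \<omega>) = (\<Sum>t\<in>\<tau> ` {..m}. c t * Z t \<omega>)"
        using combination_as_set_sum[of "{..m}" "\<lambda>l. \<eta> l / \<eta> (Suc m)" \<tau>] by auto
      have step: "\<tau> l \<le> \<tau> (Suc l)" for l
        using gap[rule_format, of l] L by linarith
      have mono: "\<tau> l \<le> \<tau> m" if "l \<le> m" for l
        using step that by (rule lift_Suc_mono_le)
      have "W (Suc m) \<omega> = \<eta> (Suc m) * (Z (\<tau> (Suc m)) \<omega> + (\<Sum>t\<in>\<tau> ` {..m}. c t * Z t \<omega>))" for \<omega>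
        using False by (simp add: W_Suc W_def c[symmetric] sum_distrib_left distrib_left)
      then have "Q (Suc m) = (\<eta> (Suc m))\<^sup>2 * (LINT \<omega>|M. (Z (\<tau> (Suc m)) \<omega> + (\<Sum>t\<in>\<tau> ` {..m}. c t * Z t \<omega>))\<^sup>2)"
        by (simp add: Q_def power_mult_distrib)
      also have "\<dots> \<ge> (\<eta> (Suc m))\<^sup>2 * \<epsilon>"
      proof (intro mult_left_mono innovation)
        fix t assume "t \<in> \<tau> ` {..m}"
        then obtain l where "l \<le> m" "t = \<tau> l" by auto
        then show "t \<le> \<tau> (Suc m) - L"
          using mono[of l] gap[rule_format, of m] by simp
      qed auto
      finally show ?thesis
        using \<epsilon> by (simp add: field_simps)
    qed
    have "Q m \<le> (LINT \<omega>|M. 2 * (W (Suc m) \<omega>)\<^sup>2 + 2 * (\<eta> (Suc m))\<^sup>2 * (Z (\<tau> (Suc m)) \<omega>)\<^sup>2)"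
      unfolding Q_def
    proof (rule integral_mono)
      have Zint: "integrable M (\<lambda>\<omega>. (Z (\<tau> (Suc m)) \<omega>)\<^sup>2)"
        using integrable_combination_square[of "{Suc m}" "\<lambda>_. 1" \<tau>] by simp
      show "integrable M (\<lambda>\<omega>. 2 * (W (Suc m) \<omega>)\<^sup>2 + 2 * (\<eta> (Suc m))\<^sup>2 * (Z (\<tau> (Suc m)) \<omega>)\<^sup>2)"
        using W_int Zint by auto
      fix \<omega>
      have "(a - b)\<^sup>2 \<le> 2 * a\<^sup>2 + 2 * b\<^sup>2" for a b :: real
        using zero_le_power2[of "a + b"] by (simp add: power2_eq_square algebra_simps)
      from this[of "W (Suc m) \<omega>" "\<eta> (Suc m) * Z (\<tau> (Suc m)) \<omega>"]
      show "(W m \<omega>)\<^sup>2 \<le> 2 * (W (Suc m) \<omega>)\<^sup>2 + 2 * (\<eta> (Suc m))\<^sup>2 * (Z (\<tau> (Suc m)) \<omega>)\<^sup>2"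
        by (simp add: W_Suc power_mult_distrib)
    qed (rule W_int)
    also have "\<dots> = 2 * Q (Suc m) + 2 * (\<eta> (Suc m))\<^sup>2"
      using W_int integrable_combination_square[of "{Suc m}" "\<lambda>_. 1" \<tau>]
      by (simp add: Q_def variance_one)
    also have "\<dots> \<le> (2 + 2 / \<epsilon>) * Q (Suc m)"
      using last by (simp add: algebra_simps)
    finally have "K * Q m \<le> (2 + 2 / \<epsilon>) * K * Q (Suc m)"
      using mult_left_mono[of "Q m" "(2 + 2 / \<epsilon>) * Q (Suc m)" K] K by (simp only: mult_ac)
    moreover have "(\<Sum>l=1..m. (\<eta> l)\<^sup>2) \<le> K * Q m"
      using IH[OF gap] by (simp add: Q_def W_def)
    ultimately have "(\<Sum>l=1..Suc m. (\<eta> l)\<^sup>2) \<le> (1 / \<epsilon> + (2 + 2 / \<epsilon>) * K) * Q (Suc m)"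
      using last by (simp add: distrib_right)
    then show "(\<Sum>l=1..Suc m. (\<eta> l)\<^sup>2)
      \<le> (1 / \<epsilon> + (2 + 2 / \<epsilon>) * K) * (LINT \<omega>|M. (\<Sum>l\<le>Suc m. \<eta> l * Z (\<tau> l) \<omega>)\<^sup>2)"
      by (simp add: Q_def W_def)
  qed
qed

text \<open>Subtracting multiples of \<open>Z 0\<close> changes only the coefficient of time \<open>\<tau> 0 = 0\<close>, on which
  coercivity makes no demand. Hence the bound does not depend on \<open>b\<close>.\<close>

lemma laplace_separated_times:
  assumes K: "K > 0"
    and coercive: "\<And>\<eta>. (\<Sum>l=1..N. (\<eta> l)\<^sup>2) \<le> K * (LINT \<omega>|M. (\<Sum>l\<le>N. \<eta> l * Z (\<tau> l) \<omega>)\<^sup>2)"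
    and \<tau>0: "\<tau> 0 = 0" and s: "s \<ge> 0"
  shows "(LINT \<omega>|M. exp (- s * (\<Sum>l=1..N. (Z (\<tau> l) \<omega> - b l * Z 0 \<omega>)\<^sup>2))) \<le> (1 / sqrt (1 + 2 * s / K)) ^ N"
proof -
  define Y where "Y l \<omega> = Z (\<tau> l) \<omega> - b l * Z 0 \<omega>" for l \<omega>
  define \<eta>' where "\<eta>' \<eta> = \<eta>(0 := - (\<Sum>l=1..N. \<eta> l * b l))" for \<eta>
  have eq: "(\<Sum>l=1..N. \<eta> l * Y l \<omega>) = (\<Sum>l\<le>N. \<eta>' \<eta> l * Z (\<tau> l) \<omega>)" for \<eta> \<omega>
  proof -
    have "{..N} = insert 0 {1..N}" by auto
    then have "(\<Sum>l\<le>N. \<eta>' \<eta> l * Z (\<tau> l) \<omega>) = - (\<Sum>l=1..N. \<eta> l * b l) * Z 0 \<omega> + (\<Sum>l=1..N. \<eta> l * Z (\<tau> l) \<omega>)"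
      by (simp add: \<eta>'_def \<tau>0)
    also have "\<dots> = (\<Sum>l=1..N. \<eta> l * Y l \<omega>)"
      by (simp add: Y_def algebra_simps sum_subtractf sum_distrib_left)
    finally show ?thesis ..
  qed
  have "(LINT \<omega>|M. exp (- s * (\<Sum>l\<in>{1..N}. (Y l \<omega>)\<^sup>2))) \<le> (1 / sqrt (1 + 2 * s / K)) ^ card {1..N}"
  proof (rule laplace_gaussian_vector_le)
    show "prob_space M" by (rule prob_space_axioms)
    show "Y l \<in> borel_measurable M" for l
      unfolding Y_def by measurable
    fix \<eta> :: "nat \<Rightarrow> real"
    show "gaussian_rv M (\<lambda>\<omega>. \<Sum>l\<in>{1..N}. \<eta> l * Y l \<omega>)"
      unfolding eq by (rule gaussian_rv_combination) simp
    show "(LINT \<omega>|M. (\<Sum>l\<in>{1..N}. \<eta> l * Y l \<omega>)) = 0"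
      unfolding eq by (rule mean_combination) simp
    have "(\<Sum>l=1..N. (\<eta>' \<eta> l)\<^sup>2) = (\<Sum>l=1..N. (\<eta> l)\<^sup>2)"
      by (intro sum.cong) (auto simp: \<eta>'_def)
    then show "(\<Sum>l\<in>{1..N}. (\<eta> l)\<^sup>2) \<le> K * (LINT \<omega>|M. (\<Sum>l\<in>{1..N}. \<eta> l * Y l \<omega>)\<^sup>2)"
      unfolding eq using coercive[of "\<eta>' \<eta>"] by simp
  qed (use K s in auto)
  then show ?thesis by (simp add: Y_def)
qed

end

section \<open>Averages over a grid\<close>

lemma exp_average_le:
  fixes S :: "nat \<Rightarrow> real"
  assumes "k \<ge> 1"
  shows "exp (- s * ((\<Sum>j=1..k. S j) / real k)) \<le> (\<Sum>j=1..k. exp (- s * S j)) / real k"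
proof -
  have "exp (\<Sum>j\<in>{1..k}. (1 / real k) *\<^sub>R (- s * S j)) \<le> (\<Sum>j\<in>{1..k}. (1 / real k) * exp (- s * S j))"
    using assms by (intro convex_on_sum[OF _ _ exp_convex]) auto
  then show ?thesis
    by (simp add: sum_divide_distrib sum_distrib_left)
qed

text \<open>The indices \<open>k + 1, ..., k (N + 1)\<close> split into \<open>k\<close> progressions of step \<open>k\<close> and length \<open>N\<close>.\<close>

lemma sum_lattice_blocks_le:
  fixes g :: "nat \<Rightarrow> real"
  assumes g: "\<And>i. g i \<ge> 0" and n: "k * (N + 1) \<le> n"
  shows "(\<Sum>j=1..k. \<Sum>l=1..N. g (j + k * l)) \<le> (\<Sum>i=1..n. g i)"
proof -
  have inj: "inj_on (\<lambda>(j, l). j + k * l) ({1..k} \<times> {1..N})"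
  proof (rule inj_onI, clarify)
    fix j l j' l'
    assume a: "j \<in> {1..k}" "j' \<in> {1..k}" and eq: "j + k * l = j' + k * l'"
    have mod: "(j - 1 + k * l) mod k = j - 1 \<and> (j - 1 + k * l) div k = l" if "j \<in> {1..k}" for j l
    proof -
      have "j - 1 < k" using that by auto
      then show ?thesis by (simp only: mod_mult_self2 mod_less div_mult_self2 div_less) simp
    qed
    have "j - 1 + k * l = j' - 1 + k * l'"
      using a eq by auto
    then have "j - 1 = j' - 1 \<and> l = l'"
      using mod[OF a(1), of l] mod[OF a(2), of l'] by metis
    then show "j = j' \<and> l = l'"
      using a by auto
  qed
  have sub: "(\<lambda>(j, l). j + k * l) ` ({1..k} \<times> {1..N}) \<subseteq> {1..n}"
  proof clarify
    fix j l assume "j \<in> {1..k}" "l \<in> {1..N}"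
    then have "j + k * l \<le> k + k * N"
      by (intro add_mono mult_left_mono) auto
    with n \<open>j \<in> {1..k}\<close> show "j + k * l \<in> {1..n}"
      by (simp add: algebra_simps)
  qed
  have "(\<Sum>j=1..k. \<Sum>l=1..N. g (j + k * l)) = sum g ((\<lambda>(j, l). j + k * l) ` ({1..k} \<times> {1..N}))"
    unfolding sum.cartesian_product by (subst sum.reindex[OF inj]) (auto intro!: sum.cong)
  also have "\<dots> \<le> (\<Sum>i=1..n. g i)"
    using sub g by (intro sum_mono2) auto
  finally show ?thesis .
qed

context stationary_gaussian
begin

text \<open>Choosing \<open>N = 2 (m + 2)\<close> with \<open>m \<ge> p\<close> makes the Laplace transform of one progression decay to
  the order \<open>m + 2\<close>, which is enough for the inverse moment of order \<open>m + 1 > p\<close>. The horizon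
  \<open>T0\<close> ensures that the blocks are at least as long as the lag \<open>L\<close> after rounding \<open>n / (N + 1)\<close> down,
  which costs at most one mesh \<open>d \<le> 1\<close>.\<close>

lemma discrete_neg_moment_bound:
  assumes tail: "(\<Inter>t::real. L2_closure M (lin_span {Z s | s. s \<le> t})) = L2_zero M"
    and p: "p > 0"
  shows "\<exists>T0>0. \<exists>C. \<forall>a d n. 0 < d \<longrightarrow> d \<le> 1 \<longrightarrow> T0 \<le> real n * d \<longrightarrow>
      neg_moment M p (\<lambda>\<omega>. 1 / real n * (\<Sum>i=1..n. (Z (real i * d) \<omega> - a (real i * d) * Z 0 \<omega>)\<^sup>2)) \<le> ennreal C"
proof -
  obtain L \<epsilon> where L: "L > 0" and \<epsilon>: "\<epsilon> > 0"
    and innovation: "\<And>s J c. finite J \<Longrightarrow> (\<And>t. t \<in> J \<Longrightarrow> t \<le> s - L) \<Longrightarrow>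
      \<epsilon> \<le> (LINT \<omega>|M. (Z s \<omega> + (\<Sum>t\<in>J. c t * Z t \<omega>))\<^sup>2)"
    using innovation_lower_bound[OF tail] by blast
  obtain m where m: "p \<le> real m"
    using real_arch_simple by blast
  define N where "N = 2 * (m + 2)"
  obtain K' where K': "K' \<ge> 0" and coercive': "\<And>\<tau> \<eta>. (\<forall>l. \<tau> l + L \<le> \<tau> (Suc l)) \<Longrightarrow>
    (\<Sum>l=1..N. (\<eta> l)\<^sup>2) \<le> K' * (LINT \<omega>|M. (\<Sum>l\<le>N. \<eta> l * Z (\<tau> l) \<omega>)\<^sup>2)"
    using coercive_on_separated_times[OF L \<epsilon> innovation, of N] by blast
  \<comment> \<open>The induction only gives a nonnegative constant; the Laplace bound divides by it.\<close>
  define K where "K = K' + 1"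
  have K: "K > 0" using K' by (simp add: K_def)
  have coercive: "(\<Sum>l=1..N. (\<eta> l)\<^sup>2) \<le> K * (LINT \<omega>|M. (\<Sum>l\<le>N. \<eta> l * Z (\<tau> l) \<omega>)\<^sup>2)"
    if "\<forall>l. \<tau> l + L \<le> \<tau> (Suc l)" for \<tau> \<eta>
  proof -
    have "0 \<le> (LINT \<omega>|M. (\<Sum>l\<le>N. \<eta> l * Z (\<tau> l) \<omega>)\<^sup>2)" by simp
    then show ?thesis
      using coercive'[OF that, of \<eta>] unfolding K_def distrib_right by linarith
  qed
  \<comment> \<open>Since \<open>n \<le> 2 (N + 1) k\<close>, this is the share of the grid average kept by the progressions.\<close>
  define c0 where "c0 = 1 / (2 * (real N + 1))"
  have c0: "c0 > 0" by (simp add: c0_def)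
  define c where "c = min 1 (2 * c0 / K)"
  have c: "0 < c" "c \<le> 1" using c0 K by (auto simp: c_def)
  define T0 where "T0 = (real N + 1) * (L + 1)"
  show ?thesis
  proof (rule exI[of _ T0], rule conjI, goal_cases)
    case 1
    show ?case using L by (simp add: T0_def)
  next
    case 2
    show ?case
    proof (intro exI[of _ "1 + 1 / c ^ (m + 2)"] allI impI)
      fix a :: "real \<Rightarrow> real" and d :: real and n :: nat
      assume d: "0 < d" "d \<le> 1" and nd: "T0 \<le> real n * d"
      define y where "y i \<omega> = Z (real i * d) \<omega> - a (real i * d) * Z 0 \<omega>" for i :: nat and \<omega>
      define X where "X \<omega> = 1 / real n * (\<Sum>i=1..n. (y i \<omega>)\<^sup>2)" for \<omega>
      have [measurable]: "y i \<in> borel_measurable M" for i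
        unfolding y_def by measurable
      have [measurable]: "X \<in> borel_measurable M"
        unfolding X_def by measurable
      have X_nonneg: "X \<omega> \<ge> 0" for \<omega>
        unfolding X_def by (intro mult_nonneg_nonneg sum_nonneg) auto
      define k where "k = n div (N + 1)"
      have n_lower: "k * (N + 1) \<le> n"
        unfolding k_def by (rule div_times_less_eq_dividend)
      have "n < (N + 1) + (N + 1) * k"
        unfolding k_def by (rule dividend_less_times_div) simp
      then have n_upper: "n < (N + 1) * (k + 1)"
        by simp
      have kL: "real k * d \<ge> L"
      proof -
        have "(real N + 1) * (L + 1) \<le> real n * d"
          using nd by (simp add: T0_def)
        also have "\<dots> \<le> ((real N + 1) * (real k + 1)) * d"
        proof (rule mult_right_mono)
          have "real n \<le> real ((N + 1) * (k + 1))"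
            using n_upper by (intro of_nat_mono) simp
          then show "real n \<le> (real N + 1) * (real k + 1)"
            by (simp add: algebra_simps)
        qed (use d in simp)
        finally have "(real N + 1) * (L + 1) \<le> (real N + 1) * ((real k + 1) * d)"
          by (simp only: mult.assoc)
        then have "L + 1 \<le> (real k + 1) * d"
          by (rule mult_left_le_imp_le) simp
        then show ?thesis
          using d by (simp add: algebra_simps)
      qed
      have k: "k \<ge> 1"
        using kL L by (cases k) auto
      have n: "n > 0"
        using n_lower k by (cases n) auto
      define S where "S j \<omega> = (\<Sum>l=1..N. (y (j + k * l) \<omega>)\<^sup>2)" for j \<omega>
      have [measurable]: "S j \<in> borel_measurable M" for j
        unfolding S_def by measurable
      have S_nonneg: "S j \<omega> \<ge> 0" for j \<omega>
        unfolding S_def by (intro sum_nonneg) auto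
      have X_lower: "c0 * ((\<Sum>j=1..k. S j \<omega>) / real k) \<le> X \<omega>" for \<omega>
      proof -
        have "real n \<le> real ((N + 1) * (k + 1))"
          using n_upper by (intro of_nat_mono) simp
        also have "\<dots> = (real N + 1) * (real k + 1)"
          by (simp add: algebra_simps)
        also have "\<dots> \<le> (real N + 1) * (2 * real k)"
          using k by (intro mult_left_mono) auto
        finally have "1 / ((real N + 1) * (2 * real k)) \<le> 1 / real n"
          using n by (intro frac_le) auto
        then have "1 / ((real N + 1) * (2 * real k)) * (\<Sum>j=1..k. S j \<omega>) \<le> 1 / real n * (\<Sum>i=1..n. (y i \<omega>)\<^sup>2)"
          using sum_lattice_blocks_le[of "\<lambda>i. (y i \<omega>)\<^sup>2" k N n] n_lower S_nonneg
          by (intro mult_mono) (auto simp: S_def intro!: sum_nonneg)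
        then show ?thesis
          by (simp add: X_def c0_def mult_ac)
      qed
      have laplace_S: "(LINT \<omega>|M. exp (- (c0 * s) * S j \<omega>)) \<le> 1 / (1 + c * s) ^ (m + 2)"
        if s: "s \<ge> 0" and j: "j \<in> {1..k}" for s j
      proof -
        \<comment> \<open>Starting the progression in the second block separates it from time 0 as well.\<close>
        define \<tau> where "\<tau> l = (if l = 0 then 0 else real (j + k * l) * d)" for l
        have gap: "\<forall>l. \<tau> l + L \<le> \<tau> (Suc l)"
        proof
          fix l
          have "0 \<le> real j * d" using d by simp
          then show "\<tau> l + L \<le> \<tau> (Suc l)"
            using kL by (simp add: \<tau>_def algebra_simps)
        qed
        have "(LINT \<omega>|M. exp (- (c0 * s) * S j \<omega>))
            = (LINT \<omega>|M. exp (- (c0 * s) * (\<Sum>l=1..N. (Z (\<tau> l) \<omega> - a (\<tau> l) * Z 0 \<omega>)\<^sup>2)))"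
          unfolding S_def y_def \<tau>_def by (intro Bochner_Integration.integral_cong arg_cong[where f=exp] refl arg_cong2[where f="(*)"] sum.cong) auto
        also have "\<dots> \<le> (1 / sqrt (1 + 2 * (c0 * s) / K)) ^ N"
          using s c0 by (intro laplace_separated_times K coercive[OF gap]) (auto simp: \<tau>_def)
        also have "\<dots> = 1 / (1 + 2 * (c0 * s) / K) ^ (m + 2)"
        proof -
          have "(1 / sqrt (1 + 2 * (c0 * s) / K)) ^ N = ((1 / sqrt (1 + 2 * (c0 * s) / K))\<^sup>2) ^ (m + 2)"
            by (simp only: N_def power_mult)
          also have "(1 / sqrt (1 + 2 * (c0 * s) / K))\<^sup>2 = 1 / (1 + 2 * (c0 * s) / K)"
            using s c0 K by (simp add: power_divide)
          finally show ?thesis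
            by (simp only: power_one_over)
        qed
        also have "\<dots> \<le> 1 / (1 + c * s) ^ (m + 2)"
        proof -
          have "c * s \<le> 2 * c0 / K * s"
            unfolding c_def using s by (intro mult_right_mono) auto
          then have le: "(1 + c * s) ^ (m + 2) \<le> (1 + 2 * (c0 * s) / K) ^ (m + 2)"
            using c s by (intro power_mono) (auto simp: mult_ac)
          have pos: "0 < 1 + c * s"
            using c s by (intro add_pos_nonneg) auto
          show ?thesis
            by (intro frac_le zero_le_one order_refl zero_less_power pos le)
        qed
        finally show ?thesis .
      qed
      have laplace: "(LINT \<omega>|M. exp (- s * X \<omega>)) \<le> 1 / (1 + c * s) ^ (m + 2)" if s: "s \<ge> 0" for s
      proof -
        have intS: "integrable M (\<lambda>\<omega>. exp (- (c0 * s) * S j \<omega>))" for j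
          using s c0 S_nonneg by (intro integrable_const_bound[where B=1]) auto
        have "(LINT \<omega>|M. exp (- s * X \<omega>)) \<le> (LINT \<omega>|M. (\<Sum>j=1..k. exp (- (c0 * s) * S j \<omega>)) / real k)"
        proof (rule integral_mono)
          show "integrable M (\<lambda>\<omega>. exp (- s * X \<omega>))"
            using s X_nonneg by (intro integrable_const_bound[where B=1]) auto
          show "integrable M (\<lambda>\<omega>. (\<Sum>j=1..k. exp (- (c0 * s) * S j \<omega>)) / real k)"
            using intS by auto
          fix \<omega>
          have "exp (- s * X \<omega>) \<le> exp (- (c0 * s) * ((\<Sum>j=1..k. S j \<omega>) / real k))"
            using mult_left_mono[OF X_lower[of \<omega>] s] by (simp add: mult_ac)
          also have "\<dots> \<le> (\<Sum>j=1..k. exp (- (c0 * s) * S j \<omega>)) / real k"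
            using k by (rule exp_average_le)
          finally show "exp (- s * X \<omega>) \<le> (\<Sum>j=1..k. exp (- (c0 * s) * S j \<omega>)) / real k" .
        qed
        also have "\<dots> = (\<Sum>j=1..k. (LINT \<omega>|M. exp (- (c0 * s) * S j \<omega>))) / real k"
          using intS by (simp only: integral_divide_zero Bochner_Integration.integral_sum)
        also have "\<dots> \<le> (\<Sum>j=1..k. 1 / (1 + c * s) ^ (m + 2)) / real k"
          using laplace_S[OF s] by (intro divide_right_mono sum_mono) auto
        also have "\<dots> = 1 / (1 + c * s) ^ (m + 2)"
          using k by simp
        finally show ?thesis .
      qed
      have "neg_moment M p X \<le> (\<integral>\<^sup>+\<omega>. 1 + inverse (ennreal (X \<omega> ^ Suc m)) \<partial>M)"
        unfolding neg_moment_def using X_nonneg p m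
        by (intro nn_integral_mono inverse_powr_le_one_plus) auto
      also have "\<dots> = 1 + (\<integral>\<^sup>+\<omega>. inverse (ennreal (X \<omega> ^ Suc m)) \<partial>M)"
        by (subst nn_integral_add) (auto simp: emeasure_space_1)
      also have "\<dots> \<le> 1 + ennreal (1 / c ^ (m + 2))"
        by (intro add_left_mono inverse_moment_le_of_laplace prob_space_axioms laplace c X_nonneg) auto
      also have "\<dots> = ennreal (1 + 1 / c ^ (m + 2))"
        using c by (subst ennreal_plus) auto
      finally show "neg_moment M p (\<lambda>\<omega>. 1 / real n * (\<Sum>i=1..n. (Z (real i * d) \<omega> - a (real i * d) * Z 0 \<omega>)\<^sup>2))
        \<le> ennreal (1 + 1 / c ^ (m + 2))"
        unfolding X_def[abs_def] y_def[abs_def] .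
    qed
  qed
qed

end

section \<open>Averages over an interval\<close>

text \<open>On each cell the mean value theorem for the primitive gives the integral as the cell length
  times an intermediate value of \<open>f\<close>, and uniform continuity compares that value with the one at
  the right end point.\<close>

lemma riemann_sum_tendsto:
  fixes f :: "real \<Rightarrow> real"
  assumes T: "T > 0" and f: "continuous_on {0..T} f"
  shows "(\<lambda>n. 1 / real n * (\<Sum>i=1..n. f (real i * (T / real n)))) \<longlonglongrightarrow> 1 / T * (LBINT t:{0..T}. f t)"
proof (rule LIMSEQ_I)
  fix e :: real assume e: "e > 0"
  define F where "F x = integral {0..x} f" for x
  have F: "(F has_real_derivative f x) (at x within {0..T})" if "x \<in> {0..T}" for x
    unfolding F_def using integral_has_real_derivative[OF f that] .
  have "uniformly_continuous_on {0..T} f"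
    using f by (rule compact_uniformly_continuous) simp
  then obtain \<delta> where \<delta>: "\<delta> > 0"
    and uc: "\<And>x y. x \<in> {0..T} \<Longrightarrow> y \<in> {0..T} \<Longrightarrow> \<bar>y - x\<bar> < \<delta> \<Longrightarrow> \<bar>f y - f x\<bar> < e / 2"
    using e unfolding uniformly_continuous_on_def dist_real_def by (meson half_gt_zero)
  obtain n0 where n0: "T / \<delta> < real n0"
    using reals_Archimedean2 by blast
  show "\<exists>n0. \<forall>n\<ge>n0. norm (1 / real n * (\<Sum>i=1..n. f (real i * (T / real n))) - 1 / T * (LBINT t:{0..T}. f t)) < e"
  proof (intro exI[of _ n0] allI impI)
    fix n assume n: "n \<ge> n0"
    have "0 < T / \<delta>" using T \<delta> by simp
    then have n_pos: "real n > 0" using n n0 by linarith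
    define h where "h = T / real n"
    have h: "h > 0" "h < \<delta>" "real n * h = T"
    proof -
      have "T / \<delta> < real n" using n n0 by linarith
      then show "h > 0" "h < \<delta>" "real n * h = T"
        using T \<delta> n_pos by (auto simp: h_def field_simps)
    qed
    have step: "\<bar>h * f (real (Suc i) * h) - (F (real (Suc i) * h) - F (real i * h))\<bar> \<le> h * (e / 2)"
      if i: "i < n" for i
    proof -
      have "real (Suc i) * h \<le> real n * h"
        using i h(1) by (intro mult_right_mono) auto
      then have le: "real (Suc i) * h \<le> T" using h by simp
      have lt: "real i * h < real (Suc i) * h" using h by simp
      have nonneg: "0 \<le> real i * h" using h by simp
      have "\<exists>x\<in>{real i * h<..<real (Suc i) * h}. F (real (Suc i) * h) - F (real i * h) = (\<lambda>v. f x * v) (real (Suc i) * h - real i * h)"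
      proof (rule mvt_simple[OF lt])
        fix x assume "real i * h \<le> x" "x \<le> real (Suc i) * h"
        then have "(F has_real_derivative f x) (at x within {0..T})"
          using le nonneg by (intro F) auto
        then have "(F has_derivative (\<lambda>v. f x * v)) (at x within {0..T})"
          by (simp add: has_field_derivative_def)
        then show "(F has_derivative (\<lambda>v. f x * v)) (at x within {real i * h..real (Suc i) * h})"
          by (rule has_derivative_subset) (use le nonneg in auto)
      qed
      then obtain x where x: "real i * h < x" "x < real (Suc i) * h"
        and mvt: "F (real (Suc i) * h) - F (real i * h) = f x * h"
        by (auto simp: algebra_simps)
      have "\<bar>f (real (Suc i) * h) - f x\<bar> < e / 2"
      proof (rule uc)
        show "x \<in> {0..T}" "real (Suc i) * h \<in> {0..T}"
          using x le nonneg by auto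
        show "\<bar>real (Suc i) * h - x\<bar> < \<delta>"
          using x h(2) by (simp add: distrib_right)
      qed
      then have "h * \<bar>f (real (Suc i) * h) - f x\<bar> \<le> h * (e / 2)"
        using h by (intro mult_left_mono) auto
      moreover have "h * f (real (Suc i) * h) - f x * h = h * (f (real (Suc i) * h) - f x)"
        by (simp add: algebra_simps)
      ultimately show ?thesis
        using h by (simp only: mvt abs_mult abs_of_pos)
    qed
    have int: "(LBINT t:{0..T}. f t) = F T - F 0"
      unfolding F_def using f by (subst set_borel_integral_eq_integral(2)) (auto intro: borel_integrable_atLeastAtMost')
    have tele: "(\<Sum>i<n. F (real (Suc i) * h) - F (real i * h)) = F T - F 0"
      using sum_lessThan_telescope[of "\<lambda>i. F (real i * h)" n] h by simp
    have shift: "(\<Sum>i=1..n. f (real i * h)) = (\<Sum>i<n. f (real (Suc i) * h))"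
      by (rule sum.reindex_bij_witness[of _ Suc "\<lambda>i. i - 1"]) auto
    have "\<bar>h * (\<Sum>i=1..n. f (real i * h)) - (F T - F 0)\<bar>
        = \<bar>\<Sum>i<n. h * f (real (Suc i) * h) - (F (real (Suc i) * h) - F (real i * h))\<bar>"
      unfolding shift tele[symmetric] sum_distrib_left sum_subtractf[symmetric] ..
    also have "\<dots> \<le> (\<Sum>i<n. h * (e / 2))"
      using step by (intro order_trans[OF sum_abs] sum_mono) auto
    also have "\<dots> = T * (e / 2)"
      using h by (simp add: mult.assoc[symmetric])
    finally have "1 / T * \<bar>h * (\<Sum>i=1..n. f (real i * h)) - (F T - F 0)\<bar> \<le> 1 / T * (T * (e / 2))"
      using T by (intro mult_left_mono) auto
    also have "\<dots> < e"
      using T e by simp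
    also have "1 / T * \<bar>h * (\<Sum>i=1..n. f (real i * h)) - (F T - F 0)\<bar>
        = \<bar>1 / real n * (\<Sum>i=1..n. f (real i * h)) - 1 / T * (F T - F 0)\<bar>"
    proof -
      have "1 / T * h = 1 / real n" using T n_pos by (simp add: h_def)
      then have "1 / real n * (\<Sum>i=1..n. f (real i * h)) - 1 / T * (F T - F 0)
        = 1 / T * (h * (\<Sum>i=1..n. f (real i * h)) - (F T - F 0))"
        by (simp only: right_diff_distrib mult.assoc[symmetric])
      then show ?thesis
        using T by (simp only: abs_mult) simp
    qed
    finally show "norm (1 / real n * (\<Sum>i=1..n. f (real i * (T / real n))) - 1 / T * (LBINT t:{0..T}. f t)) < e"
      by (simp add: int h_def)
  qed
qed

text \<open>Fatou's lemma. The limit \<open>Y\<close> may fail to be measurable, as happens for path integrals when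
  the paths are continuous only off a null set of a measure that is not complete. So the integrand
  of \<open>Y\<close> is first bounded almost everywhere by a lower limit of measurable functions.\<close>

lemma neg_moment_le_of_AE_tendsto:
  assumes p: "p > 0" and X [measurable]: "\<And>n. X n \<in> borel_measurable M"
    and nonneg: "\<And>n \<omega>. X n \<omega> \<ge> 0"
    and lim: "AE \<omega> in M. (\<lambda>n. X n \<omega>) \<longlonglongrightarrow> Y \<omega>"
    and bound: "eventually (\<lambda>n. neg_moment M p (X n) \<le> C) sequentially"
  shows "neg_moment M p Y \<le> C"
proof -
  have "neg_moment M p Y \<le> (\<integral>\<^sup>+\<omega>. liminf (\<lambda>n. inverse (ennreal (X n \<omega> powr p))) \<partial>M)"
    unfolding neg_moment_def
  proof (rule nn_integral_mono_AE, use lim in eventually_elim)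
    case (elim \<omega>)
    have "Y \<omega> \<ge> 0"
      using elim nonneg by (intro LIMSEQ_le_const) auto
    then have "(\<lambda>n. X n \<omega> powr p) \<longlonglongrightarrow> Y \<omega> powr p"
      using elim p nonneg by (intro tendsto_powr') auto
    then have "(\<lambda>n. ennreal (X n \<omega> powr p)) \<longlonglongrightarrow> ennreal (Y \<omega> powr p)"
      by (rule tendsto_ennrealI)
    moreover have "isCont (inverse :: ennreal \<Rightarrow> ennreal) (ennreal (Y \<omega> powr p))"
      using continuous_on_inverse_ennreal[OF continuous_on_id, of UNIV]
      by (simp add: continuous_on_eq_continuous_at)
    ultimately have "(\<lambda>n. inverse (ennreal (X n \<omega> powr p))) \<longlonglongrightarrow> inverse (ennreal (Y \<omega> powr p))"
      by (metis isCont_tendsto_compose)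
    then show "inverse (ennreal (Y \<omega> powr p)) \<le> liminf (\<lambda>n. inverse (ennreal (X n \<omega> powr p)))"
      by (simp add: lim_imp_Liminf)
  qed
  also have "\<dots> \<le> liminf (\<lambda>n. neg_moment M p (X n))"
    unfolding neg_moment_def by (rule nn_integral_liminf) measurable
  also have "\<dots> \<le> limsup (\<lambda>n. neg_moment M p (X n))"
    by (rule Liminf_le_Limsup) simp
  also have "\<dots> \<le> C"
    using bound by (rule Limsup_bounded)
  finally show ?thesis .
qed

context stationary_gaussian
begin

lemma continuous_neg_moment_bound:
  assumes cont: "continuous_process M Z" and a: "continuous_on UNIV a"
    and p: "p > 0" and T: "0 < T0" "T0 \<le> T"
    and discrete: "\<And>d n. 0 < d \<Longrightarrow> d \<le> 1 \<Longrightarrow> T0 \<le> real n * d \<Longrightarrow>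
      neg_moment M p (\<lambda>\<omega>. 1 / real n * (\<Sum>i=1..n. (Z (real i * d) \<omega> - a (real i * d) * Z 0 \<omega>)\<^sup>2)) \<le> C"
  shows "neg_moment M p (\<lambda>\<omega>. 1 / T * (LBINT t:{0..T}. (Z t \<omega> - a t * Z 0 \<omega>)\<^sup>2)) \<le> C"
proof (rule neg_moment_le_of_AE_tendsto[OF p])
  let ?X = "\<lambda>n \<omega>. 1 / real n * (\<Sum>i=1..n. (Z (real i * (T / real n)) \<omega> - a (real i * (T / real n)) * Z 0 \<omega>)\<^sup>2)"
  show "?X n \<in> borel_measurable M" for n
    by measurable
  show "?X n \<omega> \<ge> 0" for n \<omega>
    by (intro mult_nonneg_nonneg sum_nonneg) auto
  have "AE \<omega> in M. continuous_on UNIV (\<lambda>t. Z t \<omega>)"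
    using cont by (simp add: continuous_process_def)
  then show "AE \<omega> in M. (\<lambda>n. ?X n \<omega>) \<longlonglongrightarrow> 1 / T * (LBINT t:{0..T}. (Z t \<omega> - a t * Z 0 \<omega>)\<^sup>2)"
  proof eventually_elim
    case (elim \<omega>)
    have "continuous_on {0..T} (\<lambda>t. (Z t \<omega> - a t * Z 0 \<omega>)\<^sup>2)"
      using elim a by (intro continuous_intros) (auto intro: continuous_on_subset)
    then show ?case
      using T by (intro riemann_sum_tendsto) auto
  qed
  show "eventually (\<lambda>n. neg_moment M p (?X n) \<le> C) sequentially"
  proof -
    obtain n1 where n1: "T < real n1" using reals_Archimedean2 by blast
    have "neg_moment M p (?X n) \<le> C" if "n \<ge> n1" for n
    proof (rule discrete)
      have n: "T < real n" using n1 that by linarith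
      show "0 < T / real n" "T / real n \<le> 1" "T0 \<le> real n * (T / real n)"
        using n T by auto
    qed
    then show ?thesis by (auto simp: eventually_sequentially)
  qed
qed

end

lemma SUP_ennreal_finite:
  assumes "\<And>x. x \<in> A \<Longrightarrow> g x \<le> ennreal C"
  shows "(SUP x\<in>A. g x) < \<infinity>"
proof -
  have "(SUP x\<in>A. g x) \<le> ennreal C"
    using assms by (rule SUP_least)
  also have "\<dots> < \<infinity>" by simp
  finally show ?thesis .
qed

theorem proposition6p3:
  fixes M :: "'a measure" and Z :: "real \<Rightarrow> 'a \<Rightarrow> real" and \<theta> :: real
  assumes "prob_space M"
    and "gaussian_process M Z"
    and "continuous_process M Z"
    and "stationary_process M Z"
    and "centered_process M Z"
    and "integral\<^sup>L M (\<lambda>\<omega>. (Z 0 \<omega>)\<^sup>2) = 1"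
    and "((\<lambda>t. integral\<^sup>L M (\<lambda>\<omega>. (Z t \<omega> - Z 0 \<omega>)\<^sup>2)) \<longlongrightarrow> 0) (at 0)"
    and "(\<Inter>t::real. L2_closure M (lin_span {Z s | s. s \<le> t})) = L2_zero M"
    and "\<theta> > 0"
  shows "(\<forall>p>0. \<exists>T0>0.
            (SUP T\<in>{T0..}. neg_moment M p
               (\<lambda>\<omega>. 1 / T * (LBINT t:{0..T}. (Z t \<omega>)\<^sup>2))) < \<infinity> \<and>
            (SUP T\<in>{T0..}. neg_moment M p
               (\<lambda>\<omega>. 1 / T * (LBINT t:{0..T}. (Z t \<omega> - exp (\<theta> * t) * Z 0 \<omega>)\<^sup>2))) < \<infinity>) \<and>
         (\<forall>\<Delta>::nat \<Rightarrow> real.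
            (\<forall>n\<ge>1. \<Delta> n > 0) \<longrightarrow>
            filterlim (\<lambda>n. real n * \<Delta> n) at_top sequentially \<longrightarrow>
            \<Delta> \<longlonglongrightarrow> 0 \<longrightarrow>
            (\<forall>p>0. \<exists>n0\<ge>1.
               (SUP n\<in>{n0..}. neg_moment M p
                  (\<lambda>\<omega>. 1 / real n * (\<Sum>i=1..n. (Z (real i * \<Delta> n) \<omega>)\<^sup>2))) < \<infinity> \<and>
               (SUP n\<in>{n0..}. neg_moment M p
                  (\<lambda>\<omega>. 1 / real n *
                     (\<Sum>i=1..n. (Z (real i * \<Delta> n) \<omega> - exp (\<theta> * (real i * \<Delta> n)) * Z 0 \<omega>)\<^sup>2))) < \<infinity>))"
proof -
  interpret prob_space M by fact
  interpret stationary_gaussian M Z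
    by unfold_locales (fact assms)+
  show ?thesis
  proof (intro conjI allI impI)
    fix p :: real assume p: "p > 0"
    obtain T0 C where T0: "T0 > 0" and bound: "\<forall>a d n. 0 < d \<longrightarrow> d \<le> 1 \<longrightarrow> T0 \<le> real n * d \<longrightarrow>
      neg_moment M p (\<lambda>\<omega>. 1 / real n * (\<Sum>i=1..n. (Z (real i * d) \<omega> - a (real i * d) * Z 0 \<omega>)\<^sup>2)) \<le> ennreal C"
      using discrete_neg_moment_bound[OF assms(8) p] by (elim exE conjE) (rule that)
    have cont: "neg_moment M p (\<lambda>\<omega>. 1 / T * (LBINT t:{0..T}. (Z t \<omega> - a t * Z 0 \<omega>)\<^sup>2)) \<le> ennreal C"
      if "T \<ge> T0" "continuous_on UNIV a" for T a
      by (rule continuous_neg_moment_bound[OF assms(3) that(2) p T0 that(1) bound[rule_format]])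
    show "\<exists>T0>0.
      (SUP T\<in>{T0..}. neg_moment M p (\<lambda>\<omega>. 1 / T * (LBINT t:{0..T}. (Z t \<omega>)\<^sup>2))) < \<infinity> \<and>
      (SUP T\<in>{T0..}. neg_moment M p (\<lambda>\<omega>. 1 / T * (LBINT t:{0..T}. (Z t \<omega> - exp (\<theta> * t) * Z 0 \<omega>)\<^sup>2))) < \<infinity>"
    proof (rule exI[of _ T0], intro conjI, rule T0; rule SUP_ennreal_finite[where C=C])
      fix T assume T: "T \<in> {T0..}"
      show "neg_moment M p (\<lambda>\<omega>. 1 / T * (LBINT t:{0..T}. (Z t \<omega>)\<^sup>2)) \<le> ennreal C"
        using cont[of T "\<lambda>_. 0"] T by simp
      show "neg_moment M p (\<lambda>\<omega>. 1 / T * (LBINT t:{0..T}. (Z t \<omega> - exp (\<theta> * t) * Z 0 \<omega>)\<^sup>2)) \<le> ennreal C"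
        using T by (intro cont) (auto intro!: continuous_intros)
    qed
  next
    fix \<Delta> :: "nat \<Rightarrow> real" and p :: real
    assume pos: "\<forall>n\<ge>1. \<Delta> n > 0" and horizon: "filterlim (\<lambda>n. real n * \<Delta> n) at_top sequentially"
      and mesh: "\<Delta> \<longlonglongrightarrow> 0" and p: "p > 0"
    obtain T0 C where "T0 > 0" and bound: "\<forall>a d n. 0 < d \<longrightarrow> d \<le> 1 \<longrightarrow> T0 \<le> real n * d \<longrightarrow>
      neg_moment M p (\<lambda>\<omega>. 1 / real n * (\<Sum>i=1..n. (Z (real i * d) \<omega> - a (real i * d) * Z 0 \<omega>)\<^sup>2)) \<le> ennreal C"
      using discrete_neg_moment_bound[OF assms(8) p] by (elim exE conjE) (rule that)
    have "eventually (\<lambda>n. n \<ge> 1 \<and> \<Delta> n < 1 \<and> T0 \<le> real n * \<Delta> n) sequentially"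
      using horizon[unfolded filterlim_at_top, rule_format, of T0]
        order_tendstoD(2)[OF mesh zero_less_one] eventually_ge_at_top[of 1]
      by eventually_elim auto
    then obtain n1 where n1: "\<And>n. n \<ge> n1 \<Longrightarrow> n \<ge> 1 \<and> \<Delta> n < 1 \<and> T0 \<le> real n * \<Delta> n"
      unfolding eventually_sequentially by blast
    have disc: "neg_moment M p (\<lambda>\<omega>. 1 / real n * (\<Sum>i=1..n. (Z (real i * \<Delta> n) \<omega> - a (real i * \<Delta> n) * Z 0 \<omega>)\<^sup>2)) \<le> ennreal C"
      if "n \<ge> max 1 n1" for n a
      using n1[of n] pos that by (intro bound[rule_format]) auto
    show "\<exists>n0\<ge>1.
      (SUP n\<in>{n0..}. neg_moment M p (\<lambda>\<omega>. 1 / real n * (\<Sum>i=1..n. (Z (real i * \<Delta> n) \<omega>)\<^sup>2))) < \<infinity> \<and>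
      (SUP n\<in>{n0..}. neg_moment M p (\<lambda>\<omega>. 1 / real n *
        (\<Sum>i=1..n. (Z (real i * \<Delta> n) \<omega> - exp (\<theta> * (real i * \<Delta> n)) * Z 0 \<omega>)\<^sup>2))) < \<infinity>"
    proof (rule exI[of _ "max 1 n1"], intro conjI, simp; rule SUP_ennreal_finite[where C=C])
      fix n assume n: "n \<in> {max 1 n1..}"
      show "neg_moment M p (\<lambda>\<omega>. 1 / real n * (\<Sum>i=1..n. (Z (real i * \<Delta> n) \<omega>)\<^sup>2)) \<le> ennreal C"
        using disc[of n "\<lambda>_. 0"] n by simp
      show "neg_moment M p (\<lambda>\<omega>. 1 / real n *
        (\<Sum>i=1..n. (Z (real i * \<Delta> n) \<omega> - exp (\<theta> * (real i * \<Delta> n)) * Z 0 \<omega>)\<^sup>2)) \<le> ennreal C"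
        using disc[of n "\<lambda>t. exp (\<theta> * t)"] n by simp
    qed
  qed
qed

end
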